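(* Let $F\in\mathbb{R}[x,y]$ and let $g,h$ be nonsingular polynomial tuples defining $X\subseteq\mathbb{R}^n$ and $Y\subseteq\mathbb{R}^m$. Let $\mathcal{K}_0$ be the set of all $(x,y)\in X\times Y$ satisfying the KKT constraints $$\nabla_xF(x,y)=\sum_{i\in\mathcal{E}^X}\lambda_i(x,y)\nabla_xg_i(x),\quad \nabla_yF(x,y)=\sum_{j\in\mathcal{E}^Y}\mu_j(x,y)\nabla_yh_j(y),$$ $$\lambda_i(x,y)\ge0,\ g_i(x)\ge 0,\ \lambda_i(x,y)g_i(x)=0\ (i\in\mathcal{E}^X_2),\quad \mu_j(x,y)\le0,\ h_j(y)\ge 0,\ \mu_j(x,y)h_j(y)=0\ (j\in\mathcal{E}^Y_2),$$ and let $\mathcal{S}$ be the set of saddle points of $F$ over $X\times Y$. If the set $\mathcal{K}_0\setminus\mathcal{S}$ is finite, then the Algorithm described in the context must terminate after finitely many iterations. Moreover, let $\mathcal{S}_a$ denote the set that the Algorithm holds when it terminates. If $\mathcal{S}_a\neq\emptyset$, then each $(x^*,y^* )\in\mathcal{S}_a$ is a saddle point of $F$ over $X\times Y$; if $\mathcal{S}_a=\emptyset$, then $F$ has no saddle point over $X\times Y$.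
   Context: Setting. $x=(x_1,\dots,x_n)$, $y=(y_1,\dots,y_m)$, $F\in\mathbb{R}[x,y]$, and $$X=\{x\in\mathbb{R}^n: g_i(x)=0\ (i\in\mathcal{E}^X_1),\ g_i(x)\ge0\ (i\in\mathcal{E}^X_2)\},\quad Y=\{y\in\mathbb{R}^m: h_j(y)=0\ (j\in\mathcal{E}^Y_1),\ h_j(y)\ge0\ (j\in\mathcal{E}^Y_2)\},$$ with $g_i\in\mathbb{R}[x]$, $h_j\in\mathbb{R}[y]$, $\mathcal{E}^X=\mathcal{E}^X_1\sqcup\mathcal{E}^X_2=\{1,\dots,\ell_1\}$, $\mathcal{E}^Y=\mathcal{E}^Y_1\sqcup\mathcal{E}^Y_2=\{1,\dots,\ell_2\}$, $g=(g_1,\dots,g_{\ell_1})$, $h=(h_1,\dots,h_{\ell_2})$. A pair $(x^*,y^* )\in X\times Y$ is a saddle point of $F$ over $X\times Y$ if $F(x^*,y)\le F(x^*,y^* )\le F(x,y^* )$ for all $x\in X$, $y\in Y$. Nonsingularity and Lagrange polynomials. Let $G(x)$ be the $(n+\ell_1)\times\ell_1$ matrix whose top $n$ rows are $[\nabla_xg_1(x),\dots,\nabla_xg_{\ell_1}(x)]$ and whose bottom $\ell_1$ rows are $\mathrm{diag}(g_1(x),\dots,g_{\ell_1}(x))$; define the $(m+\ell_2)\times\ell_2$ matrix $H(y)$ in the same way from $h$. The tuple $g$ is nonsingular if $\mathrm{rank}\,G(x)=\ell_1$ for all $x\in\mathbb{C}^n$, and $h$ is nonsingular if $\mathrm{rank}\,H(y)=\ell_2$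 for all $y\in\mathbb{C}^m$. When $g,h$ are nonsingular there exist matrix polynomials $G_1(x),H_1(y)$ with $G_1G=I_{\ell_1}$, $H_1H=I_{\ell_2}$; fix such a choice. The Lagrange polynomials are $\lambda(x,y)=G_1(x)_{:,1:n}\nabla_xF(x,y)$ and $\mu(x,y)=H_1(y)_{:,1:m}\nabla_yF(x,y)$, where $A_{:,1:n}$ denotes the first $n$ columns of $A$. The Algorithm (all optimization problems are solved exactly; each "set of minimizers/maximizers" computed is a nonempty set of global optimizers of the stated problem). Step 0. Set $K_1=K_2=\mathcal{S}_a=\emptyset$. Step 1. If $\mathcal{K}_0=\emptyset$ (with $\mathcal K_0$ as in the claim), stop and report that there is no saddle point. Otherwise compute a set $K^0$ of minimizers of $F(x,y)$ over $\mathcal{K}_0$, and let $k=0$. Step 2. For each $(x^*,y^* )\in K^k$: (a) Let $\vartheta_1(y^* )$ be the minimum of $F(x,y^* )$ over all $x\in X$ with $\nabla_xF(x,y^* )=\sum_{i\in\mathcal{E}^X}\lambda_i(x,y^* )\nabla_xg_i(x)$ and $\lambda_i(x,y^* )\ge0$, $g_i(x)\ge0$, $\lambda_i(x,y^* )g_i(x)=0$ $(i\in\mathcal{E}^X_2)$, and compute a set $S_1(y^* )$ of minimizers. If $F(x^*,y^* )>\vartheta_1(y^* )$, replace $K_1$ by $K_1\cup S_1(y^* )$. (b) Let $\vartheta_2(x^* )$ be the maximum of $F(x^*,y)$ over all $y\in Y$ with $\nabla_yF(x^*,y)=\sum_{j\in\mathcal{E}^Y}\mu_j(x^*,y)\nabla_yh_j(y)$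 and $\mu_j(x^*,y)\le0$, $h_j(y)\ge0$, $\mu_j(x^*,y)h_j(y)=0$ $(j\in\mathcal{E}^Y_2)$, and compute a set $S_2(x^* )$ of maximizers. If $F(x^*,y^* )<\vartheta_2(x^* )$, replace $K_2$ by $K_2\cup S_2(x^* )$. (c) If $\vartheta_1(y^* )=F(x^*,y^* )=\vartheta_2(x^* )$, replace $\mathcal{S}_a$ by $\mathcal{S}_a\cup\{(x^*,y^* )\}$. Step 3. If $\mathcal{S}_a\ne\emptyset$, stop and output $\mathcal{S}_a$; otherwise go to Step 4. Step 4. Consider minimizing $F(x,y)$ over those $(x,y)\in\mathcal{K}_0$ satisfying in addition $F(u,y)-F(x,y)\ge0$ for all $u\in K_1$ and $F(x,v)-F(x,y)\le0$ for all $v\in K_2$. If this problem is infeasible, stop and report that there is no saddle point. Otherwise compute a set $K^{k+1}$ of minimizers, replace $k$ by $k+1$, and go to Step 2. One iteration is one pass through Steps 2–4 for a given $k$.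
   Formalization: That a point (x*,y* ) of S_a is a saddle point is claimed only if F(.,y* ) attains a minimum over X and F(x*,.) a maximum over Y; else it fails: F=x^3-3x-y^2 without constraints gives S_a={(1,0)}, not a saddle point. *)

theory Defs
  imports "HOL-Analysis.Analysis" "HOL-Library.Poly_Mapping" "HOL-Library.Function_Algebras"
begin

section \<open>Real polynomials in finitely many variables\<close>

text \<open>
  A polynomial whose variables are indexed by \<open>'v\<close> is a finitely supported map from monomials
  (exponent vectors) to coefficients; the ring structure is the convolution product of
  \<open>Poly_Mapping\<close>. With \<open>'v = 'n\<close> this is the ring of real polynomials in \<open>x\<close>, with
  \<open>'v = 'n + 'm\<close> the one in \<open>(x, y)\<close>: \<open>Inl p\<close> is the variable \<open>x_p\<close>, \<open>Inr q\<close> is \<open>y_q\<close>.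
\<close>

type_synonym 'v rpoly = "('v \<Rightarrow>\<^sub>0 nat) \<Rightarrow>\<^sub>0 real"

text \<open>The target algebra is left open, so that a real polynomial can be evaluated at real and at
  complex points.\<close>

definition peval :: "'v rpoly \<Rightarrow> ('v \<Rightarrow> 'a) \<Rightarrow> 'a::{real_algebra_1, comm_ring_1}" where
  "peval p a = (\<Sum>m\<in>Poly_Mapping.keys p.
     of_real (Poly_Mapping.lookup p m) *
       (\<Prod>v\<in>Poly_Mapping.keys m. a v ^ Poly_Mapping.lookup m v))"

text \<open>Formal partial derivative. If \<open>v\<close> does not occur in the monomial \<open>m\<close>, the truncated
  subtraction in the exponent is harmless because the coefficient is \<open>0\<close>.\<close>

definition partial :: "'v \<Rightarrow> 'v rpoly \<Rightarrow> 'v rpoly" where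
  "partial v p = (\<Sum>m\<in>Poly_Mapping.keys p.
     Poly_Mapping.single (m - Poly_Mapping.single v 1)
       (Poly_Mapping.lookup p m * of_nat (Poly_Mapping.lookup m v)))"

definition grad :: "'n rpoly \<Rightarrow> real^'n \<Rightarrow> real^'n" where
  "grad p x = (\<chi> i. peval (partial i p) (($) x))"

definition eval_xy :: "('n + 'm) rpoly \<Rightarrow> real^'n \<Rightarrow> real^'m \<Rightarrow> real" where
  "eval_xy F x y = peval F (case_sum (($) x) (($) y))"

definition grad_x :: "('n + 'm) rpoly \<Rightarrow> real^'n \<Rightarrow> real^'m \<Rightarrow> real^'n" where
  "grad_x F x y = (\<chi> i. eval_xy (partial (Inl i) F) x y)"

definition grad_y :: "('n + 'm) rpoly \<Rightarrow> real^'n \<Rightarrow> real^'m \<Rightarrow> real^'m" where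
  "grad_y F x y = (\<chi> j. eval_xy (partial (Inr j) F) x y)"

section \<open>Constraint sets, saddle points\<close>

definition constraint_set :: "(nat \<Rightarrow> 'n rpoly) \<Rightarrow> nat set \<Rightarrow> nat set \<Rightarrow> (real^'n) set" where
  "constraint_set g E1 E2 =
     {x. (\<forall>i\<in>E1. peval (g i) (($) x) = 0) \<and> (\<forall>i\<in>E2. peval (g i) (($) x) \<ge> 0)}"

definition saddle_points :: "('a \<Rightarrow> 'b \<Rightarrow> real) \<Rightarrow> 'a set \<Rightarrow> 'b set \<Rightarrow> ('a \<times> 'b) set" where
  "saddle_points f X Y = {(x, y). x \<in> X \<and> y \<in> Y \<and>
     (\<forall>u\<in>X. \<forall>v\<in>Y. f x v \<le> f x y \<and> f x y \<le> f u y)}"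

section \<open>Nonsingular tuples and Lagrange polynomials\<close>

text \<open>
  The number \<open>l\<close> of constraints may be \<open>0\<close>, so matrices are functions of a row and a column
  index: for \<open>g = (g 1, ..., g l)\<close> in the variables \<open>'n\<close> the columns are indexed by \<open>{1..l}\<close> and
  the rows by \<open>UNIV <+> {1..l}\<close>, \<open>Inl p\<close> being the \<open>p\<close>-th of the top \<open>n\<close> rows and \<open>Inr k\<close> the
  \<open>k\<close>-th of the bottom \<open>l\<close> rows.
\<close>

fun lag_mat :: "(nat \<Rightarrow> 'n rpoly) \<Rightarrow> 'n + nat \<Rightarrow> nat \<Rightarrow> 'n rpoly" where
  "lag_mat g (Inl p) j = partial p (g j)"
| "lag_mat g (Inr k) j = (if k = j then g j else 0)"

text \<open>The rank of a complex matrix with set of column indices \<open>J\<close>, as the dimension of its column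
  space. (In \<open>lag_mat\<close> the rows \<open>Inr k\<close> with \<open>k \<notin> {1..l}\<close> vanish on the columns \<open>{1..l}\<close>.)\<close>

definition mat_rank :: "'c set \<Rightarrow> ('r \<Rightarrow> 'c \<Rightarrow> complex) \<Rightarrow> nat" where
  "mat_rank J A = vector_space.dim (\<lambda>c v r. c * v r) ((\<lambda>j r. A r j) ` J)"

definition nonsingular :: "nat \<Rightarrow> (nat \<Rightarrow> ('n::finite) rpoly) \<Rightarrow> bool" where
  "nonsingular l g \<longleftrightarrow>
     (\<forall>z::complex^'n. mat_rank {1..l} (\<lambda>r j. peval (lag_mat g r j) (($) z)) = l)"

definition left_inverse_mat ::
    "nat \<Rightarrow> (nat \<Rightarrow> 'n + nat \<Rightarrow> ('n::finite) rpoly) \<Rightarrow> (nat \<Rightarrow> 'n rpoly) \<Rightarrow> bool" where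
  "left_inverse_mat l L g \<longleftrightarrow> (\<forall>i\<in>{1..l}. \<forall>j\<in>{1..l}.
     (\<Sum>r\<in>UNIV <+> {1..l}. L i r * lag_mat g r j) = (if i = j then 1 else 0))"

text \<open>Only the first \<open>n\<close> columns of \<open>G1\<close> (of \<open>H1\<close>) enter the Lagrange polynomials, which are
  used through their values at \<open>(x, y)\<close>.\<close>

definition lagrange_x ::
    "('n + 'm) rpoly \<Rightarrow> (nat \<Rightarrow> 'n + nat \<Rightarrow> 'n rpoly) \<Rightarrow> nat \<Rightarrow> real^'n \<Rightarrow> real^'m \<Rightarrow> real" where
  "lagrange_x F G1 i x y = (\<Sum>p\<in>UNIV. peval (G1 i (Inl p)) (($) x) * grad_x F x y $ p)"

definition lagrange_y ::
    "('n + 'm) rpoly \<Rightarrow> (nat \<Rightarrow> 'm + nat \<Rightarrow> 'm rpoly) \<Rightarrow> nat \<Rightarrow> real^'n \<Rightarrow> real^'m \<Rightarrow> real" where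
  "lagrange_y F H1 j x y = (\<Sum>q\<in>UNIV. peval (H1 j (Inl q)) (($) y) * grad_y F x y $ q)"

text \<open>The KKT points of minimizing \<open>F(., y)\<close> over \<open>X\<close>, and of maximizing \<open>F(x, .)\<close> over \<open>Y\<close>, with
  the multipliers expressed by the Lagrange polynomials.\<close>

definition kkt_x :: "('n + 'm) rpoly \<Rightarrow> nat \<Rightarrow> (nat \<Rightarrow> 'n rpoly) \<Rightarrow> nat set \<Rightarrow> nat set \<Rightarrow>
    (nat \<Rightarrow> 'n + nat \<Rightarrow> 'n rpoly) \<Rightarrow> real^'m \<Rightarrow> (real^'n) set" where
  "kkt_x F l g E1 E2 G1 y = {x \<in> constraint_set g E1 E2.
     grad_x F x y = (\<Sum>i=1..l. lagrange_x F G1 i x y *\<^sub>R grad (g i) x) \<and>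
     (\<forall>i\<in>E2. lagrange_x F G1 i x y \<ge> 0 \<and> peval (g i) (($) x) \<ge> 0 \<and>
        lagrange_x F G1 i x y * peval (g i) (($) x) = 0)}"

definition kkt_y :: "('n + 'm) rpoly \<Rightarrow> nat \<Rightarrow> (nat \<Rightarrow> 'm rpoly) \<Rightarrow> nat set \<Rightarrow> nat set \<Rightarrow>
    (nat \<Rightarrow> 'm + nat \<Rightarrow> 'm rpoly) \<Rightarrow> real^'n \<Rightarrow> (real^'m) set" where
  "kkt_y F l h E1 E2 H1 x = {y \<in> constraint_set h E1 E2.
     grad_y F x y = (\<Sum>j=1..l. lagrange_y F H1 j x y *\<^sub>R grad (h j) y) \<and>
     (\<forall>j\<in>E2. lagrange_y F H1 j x y \<le> 0 \<and> peval (h j) (($) y) \<ge> 0 \<and>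
        lagrange_y F H1 j x y * peval (h j) (($) y) = 0)}"

section \<open>The algorithm\<close>

text \<open>
  In this section \<open>f\<close> is the objective, \<open>C1 y\<close> and \<open>C2 x\<close> are the sets of KKT points of minimizing
  \<open>f u y\<close> over \<open>u \<in> X\<close> and of maximizing \<open>f x v\<close> over \<open>v \<in> Y\<close>, and \<open>K0\<close> is the set of all \<open>(x, y)\<close>
  with \<open>x \<in> C1 y\<close> and \<open>y \<in> C2 x\<close>. The algorithm chooses minimizers \<open>K\<close> of \<open>f\<close> over \<open>K0\<close>, tests
  them by optimizing over \<open>C1 y\<close> and \<open>C2 x\<close>, and, if none passes, cuts them off by
  the optimizers found (collected in \<open>K1\<close>, \<open>K2\<close>) and starts over with the smaller set.
\<close>

definition minimizers :: "('a \<Rightarrow> real) \<Rightarrow> 'a set \<Rightarrow> 'a set" where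
  "minimizers f A = {a. is_arg_min f (\<lambda>b. b \<in> A) a}"

definition maximizers :: "('a \<Rightarrow> real) \<Rightarrow> 'a set \<Rightarrow> 'a set" where
  "maximizers f A = {a. is_arg_max f (\<lambda>b. b \<in> A) a}"

text \<open>The optimal values over the KKT points; these are a minimum and a maximum, since they are only
  used when optimizers exist (see \<open>test_candidates\<close>). \<open>theta1\<close> need not be the infimum over the whole
  of \<open>X\<close>: \<open>f u y\<close> may attain a minimum over the KKT points, but none over \<open>X\<close>.\<close>

definition theta1 :: "('a \<Rightarrow> 'b \<Rightarrow> real) \<Rightarrow> ('b \<Rightarrow> 'a set) \<Rightarrow> 'b \<Rightarrow> real" where
  "theta1 f C1 y = (INF u\<in>C1 y. f u y)"

definition theta2 :: "('a \<Rightarrow> 'b \<Rightarrow> real) \<Rightarrow> ('a \<Rightarrow> 'b set) \<Rightarrow> 'a \<Rightarrow> real" where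
  "theta2 f C2 x = (SUP v\<in>C2 x. f x v)"

text \<open>
  \<open>Running K1 K2 Sa K\<close>: the candidates \<open>K\<close> have been computed and are about to be tested.
  \<open>Stopped Sa\<close>: the algorithm has terminated holding \<open>Sa\<close>; the report that there is no saddle
  point is \<open>Stopped {}\<close>.
\<close>

datatype ('a, 'b) config =
    Running "'a set" "'b set" "('a \<times> 'b) set" "('a \<times> 'b) set"
  | Stopped "('a \<times> 'b) set"

inductive alg_init :: "('a \<Rightarrow> 'b \<Rightarrow> real) \<Rightarrow> ('a \<times> 'b) set \<Rightarrow> ('a, 'b) config \<Rightarrow> bool"
  for f K0 where
  no_candidates: "K0 = {} \<Longrightarrow> alg_init f K0 (Stopped {})"
| start: "K0 \<noteq> {} \<Longrightarrow> K \<noteq> {} \<Longrightarrow> K \<subseteq> minimizers (\<lambda>(x, y). f x y) K0 \<Longrightarrow>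
    alg_init f K0 (Running {} {} {} K)"

text \<open>The loop over all candidates in \<open>K\<close>. Its passes do not influence each other, so the
  updates are performed at once. The computed sets of optimizers \<open>S1 y\<close>, \<open>S2 x\<close> are arbitrary
  nonempty sets of optimizers.\<close>

definition test_candidates :: "('a \<Rightarrow> 'b \<Rightarrow> real) \<Rightarrow> ('b \<Rightarrow> 'a set) \<Rightarrow> ('a \<Rightarrow> 'b set) \<Rightarrow> ('a \<times> 'b) set \<Rightarrow>
    'a set \<Rightarrow> 'b set \<Rightarrow> ('a \<times> 'b) set \<Rightarrow> 'a set \<Rightarrow> 'b set \<Rightarrow> ('a \<times> 'b) set \<Rightarrow> bool" where
  "test_candidates f C1 C2 K K1 K2 Sa K1' K2' Sa' \<longleftrightarrow> (\<exists>S1 S2.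
     (\<forall>(x, y)\<in>K. S1 y \<noteq> {} \<and> S1 y \<subseteq> minimizers (\<lambda>u. f u y) (C1 y) \<and>
                 S2 x \<noteq> {} \<and> S2 x \<subseteq> maximizers (\<lambda>v. f x v) (C2 x)) \<and>
     K1' = K1 \<union> \<Union>{S1 y | x y. (x, y) \<in> K \<and> f x y > theta1 f C1 y} \<and>
     K2' = K2 \<union> \<Union>{S2 x | x y. (x, y) \<in> K \<and> f x y < theta2 f C2 x} \<and>
     Sa' = Sa \<union> {(x, y) \<in> K. theta1 f C1 y = f x y \<and> f x y = theta2 f C2 x})"

definition cut_set :: "('a \<Rightarrow> 'b \<Rightarrow> real) \<Rightarrow> ('a \<times> 'b) set \<Rightarrow> 'a set \<Rightarrow> 'b set \<Rightarrow> ('a \<times> 'b) set" where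
  "cut_set f K0 K1 K2 = {(x, y) \<in> K0.
     (\<forall>u\<in>K1. f u y - f x y \<ge> 0) \<and> (\<forall>v\<in>K2. f x v - f x y \<le> 0)}"

text \<open>One iteration. A terminated algorithm stays in its final configuration, so
  that every execution can be written as an infinite sequence.\<close>

inductive alg_step :: "('a \<Rightarrow> 'b \<Rightarrow> real) \<Rightarrow> ('a \<times> 'b) set \<Rightarrow> ('b \<Rightarrow> 'a set) \<Rightarrow> ('a \<Rightarrow> 'b set) \<Rightarrow>
    ('a, 'b) config \<Rightarrow> ('a, 'b) config \<Rightarrow> bool"
  for f K0 C1 C2 where
  report_output: "test_candidates f C1 C2 K K1 K2 Sa K1' K2' Sa' \<Longrightarrow> Sa' \<noteq> {} \<Longrightarrow>
    alg_step f K0 C1 C2 (Running K1 K2 Sa K) (Stopped Sa')"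
| report_infeasible: "test_candidates f C1 C2 K K1 K2 Sa K1' K2' Sa' \<Longrightarrow> Sa' = {} \<Longrightarrow>
    cut_set f K0 K1' K2' = {} \<Longrightarrow>
    alg_step f K0 C1 C2 (Running K1 K2 Sa K) (Stopped Sa')"
| next_candidates: "test_candidates f C1 C2 K K1 K2 Sa K1' K2' Sa' \<Longrightarrow> Sa' = {} \<Longrightarrow>
    cut_set f K0 K1' K2' \<noteq> {} \<Longrightarrow>
    K' \<noteq> {} \<Longrightarrow> K' \<subseteq> minimizers (\<lambda>(x, y). f x y) (cut_set f K0 K1' K2') \<Longrightarrow>
    alg_step f K0 C1 C2 (Running K1 K2 Sa K) (Running K1' K2' Sa' K')"
| remain_stopped: "alg_step f K0 C1 C2 (Stopped Sa) (Stopped Sa)"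

text \<open>An execution; \<open>c k\<close> is the configuration after the initialization and \<open>k\<close> iterations.\<close>

definition alg_execution :: "('a \<Rightarrow> 'b \<Rightarrow> real) \<Rightarrow> ('a \<times> 'b) set \<Rightarrow> ('b \<Rightarrow> 'a set) \<Rightarrow> ('a \<Rightarrow> 'b set) \<Rightarrow>
    (nat \<Rightarrow> ('a, 'b) config) \<Rightarrow> bool" where
  "alg_execution f K0 C1 C2 c \<longleftrightarrow>
     alg_init f K0 (c 0) \<and> (\<forall>k. alg_step f K0 C1 C2 (c k) (c (Suc k)))"

end

theory Submission
  imports Defs
begin

text \<open>
  A minimizer of \<open>F(., y)\<close> over \<open>X\<close> satisfies the KKT conditions, and since \<open>G1\<close> is a left inverse
  its multipliers are the values of the Lagrange polynomials; the same holds for maximizers over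
  \<open>Y\<close>. Hence all saddle points lie in \<open>K0\<close>, and they survive every cut because \<open>K1 \<subseteq> X\<close> and
  \<open>K2 \<subseteq> Y\<close>. A candidate that is a saddle point passes the test, so as long as the algorithm runs
  its candidates lie in \<open>K0 - S\<close>; each of them fails the test against some computed optimizer and
  is thereby cut off for good. So \<open>K0 - S\<close> loses a point in every iteration.
\<close>

subsection \<open>Evaluation and differentiation of polynomials\<close>

lemma peval_superset:
  assumes "finite A" "Poly_Mapping.keys p \<subseteq> A"
  shows "peval p a = (\<Sum>m\<in>A. of_real (Poly_Mapping.lookup p m) *
       (\<Prod>v\<in>Poly_Mapping.keys m. a v ^ Poly_Mapping.lookup m v))"
  unfolding peval_def using assms by (intro sum.mono_neutral_left) (auto simp: in_keys_iff)

lemma peval_zero [simp]: "peval 0 a = 0"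
  by (simp add: peval_def)

lemma peval_single:
  "peval (Poly_Mapping.single m c) a =
     of_real c * (\<Prod>v\<in>Poly_Mapping.keys m. a v ^ Poly_Mapping.lookup m v)"
  by (simp add: peval_def)

lemma peval_one [simp]: "peval 1 a = 1"
  by (simp flip: single_one add: peval_single)

lemma peval_add: "peval (p + q) a = peval p a + peval q a"
proof -
  let ?A = "Poly_Mapping.keys p \<union> Poly_Mapping.keys q"
  have "Poly_Mapping.keys (p + q) \<subseteq> ?A"
    by (rule keys_add)
  then show ?thesis
    by (simp add: peval_superset[of ?A] lookup_add distrib_right sum.distrib)
qed

lemma peval_sum: "peval (\<Sum>i\<in>I. p i) a = (\<Sum>i\<in>I. peval (p i) a)"
  by (induction I rule: infinite_finite_induct) (auto simp: peval_add)

lemma prod_keys_add: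
  fixes a :: "'v \<Rightarrow> 'a::comm_monoid_mult"
  shows "(\<Prod>v\<in>Poly_Mapping.keys (m + n). a v ^ Poly_Mapping.lookup (m + n) v) =
    (\<Prod>v\<in>Poly_Mapping.keys m. a v ^ Poly_Mapping.lookup m v) *
    (\<Prod>v\<in>Poly_Mapping.keys n. a v ^ Poly_Mapping.lookup n v)"
proof -
  let ?A = "Poly_Mapping.keys m \<union> Poly_Mapping.keys n"
  have ext: "(\<Prod>v\<in>Poly_Mapping.keys k. a v ^ Poly_Mapping.lookup k v) =
      (\<Prod>v\<in>?A. a v ^ Poly_Mapping.lookup k v)" if "Poly_Mapping.keys k \<subseteq> ?A" for k
    using that by (intro prod.mono_neutral_left) (auto simp: in_keys_iff)
  show ?thesis
    unfolding ext[OF keys_add] ext[OF Un_upper1] ext[OF Un_upper2]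
    by (simp add: lookup_add power_add prod.distrib)
qed

lemma poly_mapping_eq_sum_single:
  "p = (\<Sum>m\<in>Poly_Mapping.keys p. Poly_Mapping.single m (Poly_Mapping.lookup p m))"
  by (rule poly_mapping_eqI)
    (auto simp: lookup_sum lookup_single when_def in_keys_iff)

lemma peval_mult: "peval (p * q) a = peval p a * peval q a"
proof -
  have "p * q = (\<Sum>m\<in>Poly_Mapping.keys p. \<Sum>n\<in>Poly_Mapping.keys q.
      Poly_Mapping.single (m + n) (Poly_Mapping.lookup p m * Poly_Mapping.lookup q n))"
    by (subst poly_mapping_eq_sum_single[of p], subst poly_mapping_eq_sum_single[of q])
      (simp add: sum_product mult_single)
  then have "peval (p * q) a = (\<Sum>m\<in>Poly_Mapping.keys p. \<Sum>n\<in>Poly_Mapping.keys q.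
      peval (Poly_Mapping.single m (Poly_Mapping.lookup p m)) a *
      peval (Poly_Mapping.single n (Poly_Mapping.lookup q n)) a)"
    by (simp add: peval_sum peval_single prod_keys_add mult_ac)
  then show ?thesis
    by (simp flip: sum_product peval_sum poly_mapping_eq_sum_single)
qed

lemma prod_keys_eq_prod_UNIV:
  fixes a :: "'v::finite \<Rightarrow> 'a::comm_monoid_mult"
  shows "(\<Prod>v\<in>Poly_Mapping.keys m. a v ^ Poly_Mapping.lookup m v) =
    (\<Prod>v\<in>UNIV. a v ^ Poly_Mapping.lookup m v)"
  by (intro prod.mono_neutral_left) (auto simp: in_keys_iff)

section \<open>Derivatives and continuity of polynomial functions\<close>

lemma peval_partial:
  fixes p :: "'v::finite rpoly" and a :: "'v \<Rightarrow> real"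
  shows "peval (partial v p) a = (\<Sum>m\<in>Poly_Mapping.keys p. Poly_Mapping.lookup p m *
    (of_nat (Poly_Mapping.lookup m v) * a v ^ (Poly_Mapping.lookup m v - 1) *
      (\<Prod>w\<in>UNIV - {v}. a w ^ Poly_Mapping.lookup m w)))"
proof -
  \<comment> \<open>This holds even if \<open>v\<close> does not occur in \<open>m\<close>: both
    subtractions truncate to exponent 0.\<close>
  have "(\<Prod>w\<in>UNIV. a w ^ Poly_Mapping.lookup (m - Poly_Mapping.single v 1) w) =
      a v ^ (Poly_Mapping.lookup m v - 1) * (\<Prod>w\<in>UNIV - {v}. a w ^ Poly_Mapping.lookup m w)" for m
    by (subst prod.remove[of _ v]) (auto simp: lookup_minus lookup_single intro!: prod.cong)
  then show ?thesis
    unfolding partial_def peval_sum peval_single prod_keys_eq_prod_UNIV by (simp add: mult_ac)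
qed

text \<open>The inner map \<open>a\<close> is arbitrary so that the same chain rule covers
  \<open>x\<close> alone, \<open>x\<close> with \<open>y\<close> fixed, and \<open>y\<close> with
  \<open>x\<close> fixed.\<close>

lemma has_derivative_peval:
  fixes p :: "'v::finite rpoly" and a :: "'b::real_normed_vector \<Rightarrow> 'v \<Rightarrow> real"
  assumes "\<And>v. ((\<lambda>x. a x v) has_derivative a' v) (at x)"
  shows "((\<lambda>x. peval p (a x)) has_derivative (\<lambda>d. \<Sum>v\<in>UNIV. peval (partial v p) (a x) * a' v d)) (at x)"
proof -
  have eq: "peval p b = (\<Sum>m\<in>Poly_Mapping.keys p. Poly_Mapping.lookup p m *
      (\<Prod>v\<in>UNIV. b v ^ Poly_Mapping.lookup m v))" for b :: "'v \<Rightarrow> real"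
    by (simp add: peval_def prod_keys_eq_prod_UNIV)
  show ?thesis
    unfolding eq[of "a _"]
    apply (rule has_derivative_eq_rhs)
     apply (rule has_derivative_sum has_derivative_mult_right has_derivative_prod has_derivative_power assms)+
    apply (rule ext)
    apply (simp add: peval_partial sum_distrib_left sum_distrib_right mult_ac)
    apply (rule sum.swap)
    done
qed

lemma continuous_on_peval:
  fixes p :: "'v rpoly" and a :: "'b::topological_space \<Rightarrow> 'v \<Rightarrow> real"
  assumes "\<And>v. continuous_on S (\<lambda>x. a x v)"
  shows "continuous_on S (\<lambda>x. peval p (a x))"
  unfolding peval_def by (intro continuous_intros assms)

lemma has_derivative_peval_grad:
  "((\<lambda>x. peval p (($) x)) has_derivative (\<lambda>d. grad p x \<bullet> d)) (at x)"
proof -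
  have "((\<lambda>x. x $ v) has_derivative (\<lambda>d. d $ v)) (at x)" for v
    by (intro bounded_linear_imp_has_derivative bounded_linear_vec_nth)
  from has_derivative_peval[OF this] show ?thesis
    by (simp add: grad_def inner_vec_def)
qed

lemma has_derivative_eval_xy_left:
  "((\<lambda>x. eval_xy F x y) has_derivative (\<lambda>d. grad_x F x y \<bullet> d)) (at x)"
proof -
  \<comment> \<open>The coordinates of \<open>y\<close> are constant here, so only the partial
    derivatives in the \<open>Inl\<close> variables survive.\<close>
  have "((\<lambda>x. case_sum (($) x) (($) y) v) has_derivative
      (\<lambda>d. case_sum (($) d) (\<lambda>_. 0) v)) (at x)" for v
    by (cases v) (auto intro!: bounded_linear_imp_has_derivative bounded_linear_vec_nth)
  from has_derivative_peval[of "\<lambda>x. case_sum (($) x) (($) y)", OF this, of F] show ?thesis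
    by (simp add: eval_xy_def grad_x_def inner_vec_def sum.Plus flip: UNIV_Plus_UNIV)
qed

lemma has_derivative_eval_xy_right:
  "((\<lambda>y. eval_xy F x y) has_derivative (\<lambda>d. grad_y F x y \<bullet> d)) (at y)"
proof -
  have "((\<lambda>y. case_sum (($) x) (($) y) v) has_derivative
      (\<lambda>d. case_sum (\<lambda>_. 0) (($) d) v)) (at y)" for v
    by (cases v) (auto intro!: bounded_linear_imp_has_derivative bounded_linear_vec_nth)
  from has_derivative_peval[of "\<lambda>y. case_sum (($) x) (($) y)", OF this, of F] show ?thesis
    by (simp add: eval_xy_def grad_y_def inner_vec_def sum.Plus flip: UNIV_Plus_UNIV)
qed

lemma continuous_on_grad: "continuous_on S (grad p)"
  unfolding grad_def by (intro continuous_intros continuous_on_peval)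

lemma continuous_on_grad_x: "continuous_on S (\<lambda>x. grad_x F x y)"
  unfolding grad_x_def eval_xy_def
  by (intro continuous_intros continuous_on_peval) (rename_tac v, case_tac v; simp add: continuous_intros)

lemma continuous_on_grad_y: "continuous_on S (\<lambda>y. grad_y F x y)"
  unfolding grad_y_def eval_xy_def
  by (intro continuous_intros continuous_on_peval) (rename_tac v, case_tac v; simp add: continuous_intros)

text \<open>In the lower block, column \<open>j\<close> of \<open>lag_mat\<close> has
  \<open>g j\<close> as its only nonzero entry, so the matrix identity shrinks to a gradient term
  plus one more summand. Evaluation is a ring homomorphism and carries it over to points.\<close>

lemma left_inverse_mat_eval:
  assumes "left_inverse_mat l L g" "i \<in> {1..l}" "j \<in> {1..l}"
  shows "(\<chi> p. peval (L i (Inl p)) (($) x)) \<bullet> grad (g j) x +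
    peval (L i (Inr j)) (($) x) * peval (g j) (($) x) = (if i = j then 1 else 0)"
proof -
  have mult_if_zero: "q * (if P then r else 0) = (if P then q * r else 0)" for P and q r :: "'n rpoly"
    by simp
  have "(\<Sum>r\<in>UNIV <+> {1..l}. L i r * lag_mat g r j) =
      (\<Sum>p\<in>UNIV. L i (Inl p) * partial p (g j)) + L i (Inr j) * g j"
    using assms(3) by (simp add: sum.Plus mult_if_zero cong: if_cong)
  moreover have "(\<Sum>r\<in>UNIV <+> {1..l}. L i r * lag_mat g r j) = (if i = j then 1 else 0)"
    using assms(1)[unfolded left_inverse_mat_def, rule_format, OF assms(2,3)] .
  ultimately have eq: "(\<Sum>p\<in>UNIV. L i (Inl p) * partial p (g j)) + L i (Inr j) * g j =
      (if i = j then 1 else 0)"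
    by (rule trans[OF sym])
  have "(\<chi> p. peval (L i (Inl p)) (($) x)) \<bullet> grad (g j) x +
      peval (L i (Inr j)) (($) x) * peval (g j) (($) x) =
      peval ((\<Sum>p\<in>UNIV. L i (Inl p) * partial p (g j)) + L i (Inr j) * g j) (($) x)"
    by (simp add: peval_add peval_sum peval_mult inner_vec_def grad_def)
  then show ?thesis
    unfolding eq by (cases "i = j") simp_all
qed

subsection \<open>Lagrange multipliers\<close>

text \<open>This is the penalty for an inequality constraint: squaring removes the kink of
  \<open>min t 0\<close> at 0, because the first-order remainder lies between 0 and the square of
  the increment.\<close>

lemma has_real_derivative_min_0_square:
  "((\<lambda>t. (min t 0)\<^sup>2) has_real_derivative 2 * min t 0) (at t)"
proof -
  have *: "(min (t + h) 0)\<^sup>2 - (min t 0)\<^sup>2 - 2 * min t 0 * h \<in> {0..h\<^sup>2}" for h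
  proof -
    consider "t \<le> 0" "t + h \<le> 0" | "t \<le> 0" "t + h \<ge> 0" | "t \<ge> 0" "t + h \<le> 0" | "t \<ge> 0" "t + h \<ge> 0"
      by linarith
    then show ?thesis
    proof cases
      case 1
      then show ?thesis by (simp add: power2_eq_square algebra_simps)
    next
      case 2
      \<comment> \<open>This product is the remainder, and the square below is its distance to the
        upper bound; in case 3 the two swap roles.\<close>
      have "0 \<le> (- t) * (t + 2 * h)"
        using 2 by (intro mult_nonneg_nonneg) auto
      moreover have "0 \<le> (t + h)\<^sup>2" by simp
      ultimately show ?thesis using 2 by (simp add: power2_eq_square algebra_simps)
    next
      case 3
      have "0 \<le> t * (- t - 2 * h)"
        using 3 by (intro mult_nonneg_nonneg) auto
      moreover have "0 \<le> (t + h)\<^sup>2" by simp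
      ultimately show ?thesis using 3 by (simp add: power2_eq_square algebra_simps)
    next
      case 4
      then show ?thesis by simp
    qed
  qed
  have "((\<lambda>h. ((min (t + h) 0)\<^sup>2 - (min t 0)\<^sup>2) / h - 2 * min t 0) \<longlongrightarrow> 0) (at 0)"
  proof (rule Lim_null_comparison)
    have "norm (((min (t + h) 0)\<^sup>2 - (min t 0)\<^sup>2) / h - 2 * min t 0) \<le> \<bar>h\<bar>" if "h \<noteq> 0" for h
    proof -
      have "((min (t + h) 0)\<^sup>2 - (min t 0)\<^sup>2) / h - 2 * min t 0 =
          ((min (t + h) 0)\<^sup>2 - (min t 0)\<^sup>2 - 2 * min t 0 * h) / h"
        using that by (simp add: field_simps)
      also have "norm \<dots> \<le> h\<^sup>2 / \<bar>h\<bar>"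
        using *[of h] by (auto simp: abs_divide intro!: divide_right_mono)
      finally show ?thesis
        using that by (cases "h \<ge> 0") (simp_all add: power2_eq_square)
    qed
    then show "\<forall>\<^sub>F h in at 0. norm (((min (t + h) 0)\<^sup>2 - (min t 0)\<^sup>2) / h - 2 * min t 0) \<le> \<bar>h\<bar>"
      by (auto simp: eventually_at_filter)
    show "((\<lambda>h. \<bar>h\<bar>) \<longlongrightarrow> (0::real)) (at 0)"
      by (rule tendsto_eq_intros | simp)+
  qed
  then show ?thesis
    unfolding DERIV_def by (simp add: LIM_zero_iff)
qed

text \<open>The vector \<open>m\<close> solves a fixed-point equation whose matrix tends to 0. Once
  its entries sum to at most 1/2 in absolute value, the 1-norm of \<open>m\<close> is at most twice
  that of \<open>b\<close>. So \<open>m\<close> is bounded without any prior assumption, and the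
  perturbation vanishes in the limit.\<close>

lemma tendsto_perturbed_linear_system:
  fixes m b :: "'i \<Rightarrow> 'n \<Rightarrow> real" and d :: "'i \<Rightarrow> 'i \<Rightarrow> 'n \<Rightarrow> real"
  assumes "finite I"
    and b: "\<And>j. j \<in> I \<Longrightarrow> (b j \<longlongrightarrow> l j) N"
    and d: "\<And>i j. i \<in> I \<Longrightarrow> j \<in> I \<Longrightarrow> (d j i \<longlongrightarrow> 0) N"
    and ev: "\<forall>\<^sub>F n in N. \<forall>j\<in>I. m j n = b j n + (\<Sum>i\<in>I. m i n * d j i n)"
    and j: "j \<in> I"
  shows "(m j \<longlongrightarrow> l j) N"
proof -
  define D where "D n = (\<Sum>j\<in>I. \<Sum>i\<in>I. \<bar>d j i n\<bar>)" for n
  define B where "B n = (\<Sum>j\<in>I. \<bar>b j n\<bar>)" for n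
  define M where "M n = (\<Sum>j\<in>I. \<bar>m j n\<bar>)" for n
  have D0: "(D \<longlongrightarrow> 0) N"
  proof -
    have "(D \<longlongrightarrow> (\<Sum>j\<in>I. \<Sum>i\<in>I. \<bar>0\<bar>)) N"
      unfolding D_def by (intro tendsto_sum tendsto_rabs d)
    then show ?thesis by simp
  qed
  have B: "(B \<longlongrightarrow> (\<Sum>j\<in>I. \<bar>l j\<bar>)) N"
    unfolding B_def by (intro tendsto_sum tendsto_rabs b)
  have diff: "\<bar>m j n - b j n\<bar> \<le> 2 * B n * D n"
    if eq: "\<forall>j\<in>I. m j n = b j n + (\<Sum>i\<in>I. m i n * d j i n)" and "D n \<le> 1 / 2" and "j \<in> I" for j n
  proof -
    have row: "\<bar>\<Sum>i\<in>I. m i n * d j i n\<bar> \<le> M n * (\<Sum>i\<in>I. \<bar>d j i n\<bar>)" if "j \<in> I" for j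
    proof -
      have "\<bar>\<Sum>i\<in>I. m i n * d j i n\<bar> \<le> (\<Sum>i\<in>I. \<bar>m i n\<bar> * \<bar>d j i n\<bar>)"
        by (rule order_trans[OF sum_abs]) (simp add: abs_mult)
      also have "\<dots> \<le> (\<Sum>i\<in>I. M n * \<bar>d j i n\<bar>)"
        unfolding M_def by (intro sum_mono mult_right_mono member_le_sum) (use \<open>finite I\<close> in auto)
      finally show ?thesis by (simp add: sum_distrib_left)
    qed
    have M0: "0 \<le> M n" by (simp add: M_def sum_nonneg)
    have "M n \<le> (\<Sum>j\<in>I. \<bar>b j n\<bar> + M n * (\<Sum>i\<in>I. \<bar>d j i n\<bar>))"
      unfolding M_def[of n]
    proof (rule sum_mono)
      fix j assume "j \<in> I"
      then show "\<bar>m j n\<bar> \<le> \<bar>b j n\<bar> + (\<Sum>j\<in>I. \<bar>m j n\<bar>) * (\<Sum>i\<in>I. \<bar>d j i n\<bar>)"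
        using row[of j] eq abs_triangle_ineq[of "b j n" "\<Sum>i\<in>I. m i n * d j i n"]
        by (force simp: M_def)
    qed
    also have "\<dots> = B n + M n * D n"
      by (simp add: B_def D_def sum.distrib sum_distrib_left)
    \<comment> \<open>Half of \<open>M n\<close> is absorbed into the left-hand side.\<close>
    also have "\<dots> \<le> B n + M n * (1 / 2)"
      using that M0 by (intro add_mono mult_left_mono) auto
    finally have M: "M n \<le> 2 * B n" by simp
    have "\<bar>m j n - b j n\<bar> \<le> M n * (\<Sum>i\<in>I. \<bar>d j i n\<bar>)"
      using row[OF \<open>j \<in> I\<close>] eq \<open>j \<in> I\<close> by force
    also have "\<dots> \<le> M n * D n"
      unfolding D_def using \<open>finite I\<close> \<open>j \<in> I\<close> M0
      by (intro mult_left_mono member_le_sum[of j I "\<lambda>j. \<Sum>i\<in>I. \<bar>d j i n\<bar>"]) (auto intro: sum_nonneg)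
    also have "\<dots> \<le> 2 * B n * D n"
      using M by (intro mult_right_mono) (auto simp: D_def intro!: sum_nonneg)
    finally show ?thesis .
  qed
  have "\<forall>\<^sub>F n in N. D n < 1 / 2"
    using D0 by (rule order_tendstoD) simp
  with ev have "\<forall>\<^sub>F n in N. norm (m j n - b j n) \<le> 2 * B n * D n"
  proof eventually_elim
    case (elim n)
    then show ?case
      using diff[OF _ _ j, of n] by (metis less_imp_le real_norm_def)
  qed
  moreover have "((\<lambda>n. 2 * B n * D n) \<longlongrightarrow> 0) N"
    using tendsto_mult[OF tendsto_mult[OF tendsto_const[of 2] B] D0] by simp
  ultimately have "((\<lambda>n. m j n - b j n) \<longlongrightarrow> 0) N"
    by (rule Lim_null_comparison)
  from tendsto_add[OF this b[OF j]] show ?thesis by simp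
qed

text \<open>The penalty method: minimizers of the penalized functions near \<open>x\<close> converge to \<open>x\<close>, their
  stationarity conditions have the required form up to the factors \<open>- 2 n \<psi>\<^sub>i (g\<^sub>i)\<close>, and the left
  inverse forces these factors to converge.\<close>

lemma lagrange_multipliers_of_minimizer:
  fixes \<phi> :: "'a::euclidean_space \<Rightarrow> real" and g :: "'i \<Rightarrow> 'a \<Rightarrow> real"
    and \<phi>' :: "'a \<Rightarrow> 'a" and \<gamma> L :: "'i \<Rightarrow> 'a \<Rightarrow> 'a" and M :: "'i \<Rightarrow> 'i \<Rightarrow> 'a \<Rightarrow> real"
  assumes fin: "finite I" and J: "J \<subseteq> I"
    and d\<phi>: "\<And>u. (\<phi> has_derivative (\<lambda>d. \<phi>' u \<bullet> d)) (at u)"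
    and dg: "\<And>i u. i \<in> I \<Longrightarrow> (g i has_derivative (\<lambda>d. \<gamma> i u \<bullet> d)) (at u)"
    and c\<phi>: "continuous_on UNIV \<phi>'"
    and c\<gamma>: "\<And>i. i \<in> I \<Longrightarrow> continuous_on UNIV (\<gamma> i)"
    and cL: "\<And>i. i \<in> I \<Longrightarrow> continuous_on UNIV (L i)"
    and cM: "\<And>i j. i \<in> I \<Longrightarrow> j \<in> I \<Longrightarrow> continuous_on UNIV (M i j)"
    and inv: "\<And>i j u. i \<in> I \<Longrightarrow> j \<in> I \<Longrightarrow>
      L i u \<bullet> \<gamma> j u + M i j u * g j u = (if i = j then 1 else 0)"
    and X: "X = {u. (\<forall>i\<in>I - J. g i u = 0) \<and> (\<forall>i\<in>J. g i u \<ge> 0)}"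
    and x: "x \<in> X" and min: "\<And>u. u \<in> X \<Longrightarrow> \<phi> x \<le> \<phi> u"
  shows "\<phi>' x = (\<Sum>i\<in>I. (L i x \<bullet> \<phi>' x) *\<^sub>R \<gamma> i x)"
    and "\<And>i. i \<in> J \<Longrightarrow> L i x \<bullet> \<phi>' x \<ge> 0"
    and "\<And>i. i \<in> J \<Longrightarrow> (L i x \<bullet> \<phi>' x) * g i x = 0"
proof -
  \<comment> \<open>The violation of constraint \<open>i\<close> at value \<open>t\<close>, with
    indices in \<open>J\<close> standing for inequalities; its square is differentiable in both
    cases.\<close>
  define \<psi> where "\<psi> i t = (if i \<in> J then min t 0 else t)" for i and t :: real
  have d\<psi>: "((\<lambda>t. (\<psi> i t)\<^sup>2) has_real_derivative 2 * \<psi> i t) (at t)" for i t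
  proof (cases "i \<in> J")
    case True
    then show ?thesis
      by (simp add: \<psi>_def has_real_derivative_min_0_square)
  next
    case False
    then show ?thesis
      by (auto simp: \<psi>_def intro!: derivative_eq_intros)
  qed
  have c\<psi>: "continuous_on UNIV (\<psi> i)" for i
    unfolding \<psi>_def by (cases "i \<in> J") (auto intro!: continuous_intros)
  have "\<psi> i t = 0 \<longleftrightarrow> (if i \<in> J then t \<ge> 0 else t = 0)" for i t
    by (auto simp: \<psi>_def)
  then have feasible: "u \<in> X \<longleftrightarrow> (\<forall>i\<in>I. \<psi> i (g i u) = 0)" for u
    unfolding X using J by auto
  have cont\<phi>: "continuous_on S \<phi>" for S
    using d\<phi> by (meson continuous_at_imp_continuous_on has_derivative_continuous)
  have contg: "continuous_on S (g i)" if "i \<in> I" for S i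
    using dg[OF that] by (meson continuous_at_imp_continuous_on has_derivative_continuous)
  have cont\<psi>g: "continuous_on S (\<lambda>u. \<psi> i (g i u))" if "i \<in> I" for S i
    using continuous_on_compose2[OF c\<psi> contg[OF that]] by simp
  define Q where "Q u = (\<Sum>i\<in>I. (\<psi> i (g i u))\<^sup>2)" for u
  have contQ: "continuous_on S Q" for S
    unfolding Q_def by (intro continuous_intros cont\<psi>g)
  have Q0: "0 \<le> Q u" for u by (simp add: Q_def sum_nonneg)
  have Qx: "Q u = 0 \<longleftrightarrow> u \<in> X" for u
    unfolding Q_def feasible using fin by (simp add: sum_nonneg_eq_0_iff)
  \<comment> \<open>The squared distance to \<open>x\<close> makes \<open>x\<close> the strict
    minimizer of the unpenalized part over \<open>X\<close>; this is what forces the penalized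
    minimizers to approach \<open>x\<close> and no other minimizer.\<close>
  define P where "P n u = \<phi> u + (u - x) \<bullet> (u - x) + real n * Q u" for n u
  have contP: "continuous_on S (P n)" for S n
    unfolding P_def by (intro continuous_intros cont\<phi> contQ)
  have "\<exists>u\<in>cball x 1. \<forall>v\<in>cball x 1. P n u \<le> P n v" for n
    by (rule continuous_attains_inf) (auto intro: contP)
  then obtain u where u: "u n \<in> cball x 1" and umin: "v \<in> cball x 1 \<Longrightarrow> P n (u n) \<le> P n v" for n v
    by metis
  obtain z r where z: "z \<in> cball x 1" and r: "strict_mono r" and lim: "(u \<circ> r) \<longlonglongrightarrow> z"
    using compact_cball[of x 1] u unfolding compact_def by metis
  have limc: "(\<lambda>n. F (u (r n))) \<longlonglongrightarrow> F z" if "continuous_on UNIV F" for F :: "'a \<Rightarrow> 'c::topological_space"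
    using continuous_on_tendsto_compose[OF that lim] by simp
  have Pu: "P n (u n) \<le> \<phi> x" for n
    using umin[of x n] Qx[of x] x by (simp add: P_def)
  obtain B where B: "B \<le> \<phi> v" if "v \<in> cball x 1" for v
    using continuous_attains_inf[OF compact_cball _ cont\<phi>, of x 1] by fastforce
  have "Q z = 0"
  proof -
    have "real n * Q (u n) \<le> \<phi> x - B" for n
      using Pu[of n] B[OF u[of n]] inner_ge_zero[of "u n - x"] unfolding P_def by linarith
    \<comment> \<open>A strictly increasing \<open>r\<close> satisfies \<open>n <= r n\<close>, so
      \<open>r n\<close> is positive and may be divided by.\<close>
    then have "Q (u (r n)) \<le> (\<phi> x - B) * inverse (real (r n))" if "n > 0" for n
      using that strict_mono_imp_increasing[OF r, of n] by (simp add: field_simps)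
    then have "\<forall>\<^sub>F n in sequentially. norm (Q (u (r n))) \<le> (\<phi> x - B) * inverse (real (r n))"
      using Q0 by (auto intro!: eventually_sequentiallyI[of 1])
    moreover have "(\<lambda>n. (\<phi> x - B) * inverse (real (r n))) \<longlonglongrightarrow> 0"
      using LIMSEQ_subseq_LIMSEQ[OF lim_inverse_n r] by (auto simp: o_def intro!: tendsto_mult_right_zero)
    ultimately have "(\<lambda>n. Q (u (r n))) \<longlonglongrightarrow> 0"
      by (rule Lim_null_comparison)
    with limc[OF contQ] show ?thesis
      by (rule LIMSEQ_unique)
  qed
  then have "z \<in> X" by (simp add: Qx)
  \<comment> \<open>Drop the nonnegative penalty and pass to the limit. As \<open>z\<close> is
    feasible, minimality of \<open>x\<close> then leaves no room for a positive distance.\<close>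
  have "\<phi> z + (z - x) \<bullet> (z - x) \<le> \<phi> x"
  proof (rule LIMSEQ_le_const2)
    show "(\<lambda>n. \<phi> (u (r n)) + (u (r n) - x) \<bullet> (u (r n) - x)) \<longlonglongrightarrow> \<phi> z + (z - x) \<bullet> (z - x)"
      by (intro limc[of "\<lambda>v. \<phi> v + (v - x) \<bullet> (v - x)"] continuous_intros cont\<phi>)
    show "\<exists>N. \<forall>n\<ge>N. \<phi> (u (r n)) + (u (r n) - x) \<bullet> (u (r n) - x) \<le> \<phi> x"
    proof (intro exI allI impI)
      fix n
      have "0 \<le> real (r n) * Q (u (r n))" by (simp add: Q0)
      with Pu[of "r n"] show "\<phi> (u (r n)) + (u (r n) - x) \<bullet> (u (r n) - x) \<le> \<phi> x"
        by (simp add: P_def)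
    qed
  qed
  with min[OF \<open>z \<in> X\<close>] have "(z - x) \<bullet> (z - x) = 0"
    using inner_ge_zero[of "z - x"] by linarith
  then have "z = x" by simp
  define v where "v n = u (r n)" for n
  have limv: "(\<lambda>n. F (v n)) \<longlonglongrightarrow> F x" if "continuous_on UNIV F" for F :: "'a \<Rightarrow> 'c::topological_space"
    using limc[OF that] by (simp add: v_def \<open>z = x\<close>)
  \<comment> \<open>The gradient of the unpenalized part of \<open>P\<close> at \<open>v n\<close>.
    With the factors \<open>m\<close> below, the gradient of the penalty is minus the sum of the
    \<open>m i n *\<^sub>R \<gamma> i (v n)\<close>, so the stationarity condition is an equation
    between \<open>w\<close> and that sum.\<close>
  define w where "w n = \<phi>' (v n) + 2 *\<^sub>R (v n - x)" for n
  have limw: "w \<longlonglongrightarrow> \<phi>' x"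
    using limv[of "\<lambda>v. \<phi>' v + 2 *\<^sub>R (v - x)"] by (simp add: w_def[abs_def] continuous_intros c\<phi>)
  define m where "m i n = - (real (r n) * (2 * \<psi> i (g i (v n))))" for i n
  have stationary: "\<forall>\<^sub>F n in sequentially. w n = (\<Sum>i\<in>I. m i n *\<^sub>R \<gamma> i (v n))"
  proof -
    \<comment> \<open>A minimizer over the closed ball is stationary once it lies in the open
      ball.\<close>
    have "\<forall>\<^sub>F n in sequentially. v n \<in> ball x 1"
      using limv[of "\<lambda>v. v"] by (intro topological_tendstoD[of _ x]) auto
    then show ?thesis
    proof eventually_elim
      case (elim n)
      have dP: "(P (r n) has_derivative (\<lambda>d. w n \<bullet> d - (\<Sum>i\<in>I. m i n * (\<gamma> i (v n) \<bullet> d)))) (at (v n))"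
      proof -
        have "((\<lambda>u. (\<psi> i (g i u))\<^sup>2) has_derivative
            (\<lambda>d. (2 * \<psi> i (g i (v n))) * (\<gamma> i (v n) \<bullet> d))) (at (v n))" if "i \<in> I" for i
          using has_derivative_compose[OF dg[OF that] d\<psi>[unfolded has_field_derivative_def]] by simp
        then have dQ: "(Q has_derivative
            (\<lambda>d. \<Sum>i\<in>I. (2 * \<psi> i (g i (v n))) * (\<gamma> i (v n) \<bullet> d))) (at (v n))"
          unfolding Q_def by (rule has_derivative_sum)
        have "(P (r n) has_derivative (\<lambda>d. \<phi>' (v n) \<bullet> d + ((v n - x) \<bullet> d + d \<bullet> (v n - x)) +
            real (r n) * (\<Sum>i\<in>I. (2 * \<psi> i (g i (v n))) * (\<gamma> i (v n) \<bullet> d)))) (at (v n))"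
          unfolding P_def
          by (intro has_derivative_add d\<phi> has_derivative_mult_right dQ)
            (auto intro!: derivative_eq_intros)
        then show ?thesis
          by (rule has_derivative_eq_rhs)
            (simp add: w_def m_def fun_eq_iff inner_commute algebra_simps sum_distrib_left sum_negf
              inner_add_left inner_diff_left)
      qed
      have "(\<lambda>d. w n \<bullet> d - (\<Sum>i\<in>I. m i n * (\<gamma> i (v n) \<bullet> d))) = (\<lambda>d. 0)"
      proof (rule differential_zero_maxmin[OF elim open_ball dP])
        show "(\<forall>y\<in>ball x 1. P (r n) y \<le> P (r n) (v n)) \<or> (\<forall>y\<in>ball x 1. P (r n) (v n) \<le> P (r n) y)"
          using umin by (auto simp: v_def)
      qed
      then have "(w n - (\<Sum>i\<in>I. m i n *\<^sub>R \<gamma> i (v n))) \<bullet> d = 0" for d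
        by (simp add: inner_diff_left inner_sum_left fun_eq_iff)
      from this[of "w n - (\<Sum>i\<in>I. m i n *\<^sub>R \<gamma> i (v n))"] show ?case by simp
    qed
  qed
  have inactive: "\<forall>\<^sub>F n in sequentially. m i n = 0" if "i \<in> I" "g i x \<noteq> 0" for i
  proof -
    \<comment> \<open>At the feasible point \<open>x\<close> only an inequality can be nonzero, and
      then it is positive. It stays positive near \<open>x\<close>, where its penalty
      vanishes.\<close>
    have "i \<in> J" "g i x > 0"
      using x that by (auto simp: X less_le)
    then have "\<forall>\<^sub>F n in sequentially. g i (v n) > 0"
      using limv[OF contg[OF \<open>i \<in> I\<close>]] by (intro order_tendstoD(1)) auto
    then show ?thesis
      by eventually_elim (simp add: m_def \<psi>_def \<open>i \<in> J\<close>)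
  qed
  \<comment> \<open>Pairing stationarity with \<open>L j\<close> and using \<open>inv\<close> gives
    a linear system for \<open>m\<close> that differs from the identity by the products of
    \<open>M j i\<close> and \<open>g i\<close>. These tend to 0 if \<open>g i x = 0\<close>;
    otherwise \<open>m i n\<close> is eventually 0, so the coefficient may be set to 0.\<close>
  define d where "d j i n = (if g i x = 0 then - (M j i (v n) * g i (v n)) else 0)" for j i n
  have d0: "d j i \<longlonglongrightarrow> 0" if "i \<in> I" "j \<in> I" for i j
    using tendsto_minus[OF limv[OF continuous_on_mult[OF cM contg], of j i i]] that
    by (cases "g i x = 0") (auto simp: d_def[abs_def])
  have "\<forall>\<^sub>F n in sequentially. \<forall>i\<in>I. g i x \<noteq> 0 \<longrightarrow> m i n = 0"
    using fin inactive by (intro eventually_ball_finite) (auto intro: eventually_mono)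
  with stationary have
    "\<forall>\<^sub>F n in sequentially. \<forall>j\<in>I. m j n = L j (v n) \<bullet> w n - (\<Sum>i\<in>I. m i n * d j i n)"
  proof eventually_elim
    case (elim n)
    show ?case
    proof
      fix j assume j: "j \<in> I"
      have "L j (v n) \<bullet> w n = (\<Sum>i\<in>I. m i n * (L j (v n) \<bullet> \<gamma> i (v n)))"
        by (simp add: elim(1) inner_sum_right)
      also have "\<dots> = (\<Sum>i\<in>I. (if j = i then m i n else 0) + m i n * d j i n)"
      proof (rule sum.cong[OF refl])
        fix i assume i: "i \<in> I"
        have "L j (v n) \<bullet> \<gamma> i (v n) = (if j = i then 1 else 0) - M j i (v n) * g i (v n)"
          using inv[OF j i, of "v n"] by linarith
        then show "m i n * (L j (v n) \<bullet> \<gamma> i (v n)) = (if j = i then m i n else 0) + m i n * d j i n"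
          using elim(2) i by (cases "g i x = 0") (simp_all add: d_def right_diff_distrib)
      qed
      also have "\<dots> = m j n + (\<Sum>i\<in>I. m i n * d j i n)"
        using fin j by (simp add: sum.distrib)
      finally show "m j n = L j (v n) \<bullet> w n - (\<Sum>i\<in>I. m i n * d j i n)" by simp
    qed
  qed
  then have ev: "\<forall>\<^sub>F n in sequentially. \<forall>j\<in>I. m j n = L j (v n) \<bullet> w n + (\<Sum>i\<in>I. m i n * - d j i n)"
    by (simp add: sum_negf)
  have limm: "m j \<longlonglongrightarrow> L j x \<bullet> \<phi>' x" if "j \<in> I" for j
    using fin _ _ ev that
  proof (rule tendsto_perturbed_linear_system)
    show "(\<lambda>n. L j (v n) \<bullet> w n) \<longlonglongrightarrow> L j x \<bullet> \<phi>' x" if "j \<in> I" for j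
      by (intro tendsto_inner limw limv cL that)
    show "(\<lambda>n. - d j i n) \<longlonglongrightarrow> 0" if "i \<in> I" "j \<in> I" for i j
      using tendsto_minus[OF d0[OF that]] by simp
  qed
  show "\<phi>' x = (\<Sum>i\<in>I. (L i x \<bullet> \<phi>' x) *\<^sub>R \<gamma> i x)"
  proof (rule LIMSEQ_unique[OF limw])
    have "(\<lambda>n. \<Sum>i\<in>I. m i n *\<^sub>R \<gamma> i (v n)) \<longlonglongrightarrow> (\<Sum>i\<in>I. (L i x \<bullet> \<phi>' x) *\<^sub>R \<gamma> i x)"
      by (intro tendsto_intros limm limv c\<gamma>)
    then show "w \<longlonglongrightarrow> (\<Sum>i\<in>I. (L i x \<bullet> \<phi>' x) *\<^sub>R \<gamma> i x)"
      by (rule Lim_transform_eventually) (use stationary in eventually_elim, simp)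
  qed
  show "L i x \<bullet> \<phi>' x \<ge> 0" if "i \<in> J" for i
    \<comment> \<open>For \<open>i\<close> in \<open>J\<close> the value of \<open>\<psi>\<close> is
      never positive, so \<open>m i n\<close> is never negative.\<close>
    using that J by (intro LIMSEQ_le_const[OF limm]) (auto simp: m_def \<psi>_def mult_nonneg_nonpos)
  show "(L i x \<bullet> \<phi>' x) * g i x = 0" if "i \<in> J" for i
  proof (cases "g i x = 0")
    case False
    with that J have "m i \<longlonglongrightarrow> 0"
      using inactive[of i] by (intro tendsto_eventually) auto
    with limm[of i] that J have "L i x \<bullet> \<phi>' x = 0"
      by (auto intro: LIMSEQ_unique)
    then show ?thesis by simp
  qed simp
qed

subsection \<open>Minimizers are KKT points\<close>

lemma in_minimizers_iff: "a \<in> minimizers f A \<longleftrightarrow> a \<in> A \<and> (\<forall>b\<in>A. f a \<le> f b)"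
  by (auto simp: minimizers_def is_arg_min_def not_less)

lemma in_maximizers_iff: "a \<in> maximizers f A \<longleftrightarrow> a \<in> A \<and> (\<forall>b\<in>A. f b \<le> f a)"
  by (auto simp: maximizers_def is_arg_max_def not_less)

text \<open>The upper and lower blocks of the left inverse provide the vectors \<open>L\<close> and
  the scalars \<open>M\<close> of the multiplier rule. The objective is kept arbitrary so that it
  can be \<open>F(., y)\<close> as well as \<open>-F(x, .)\<close>.\<close>

lemma constraint_set_minimizer_KKT:
  fixes \<phi> :: "real^'n \<Rightarrow> real" and g :: "nat \<Rightarrow> ('n::finite) rpoly"
  assumes E: "E1 \<union> E2 = {1..l}" "E1 \<inter> E2 = {}" and L: "left_inverse_mat l L g"
    and d\<phi>: "\<And>u. (\<phi> has_derivative (\<lambda>d. \<phi>' u \<bullet> d)) (at u)"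
    and c\<phi>: "continuous_on UNIV \<phi>'"
    and x: "x \<in> minimizers \<phi> (constraint_set g E1 E2)"
  defines "\<mu> \<equiv> \<lambda>i. \<Sum>p\<in>UNIV. peval (L i (Inl p)) (($) x) * \<phi>' x $ p"
  shows "\<phi>' x = (\<Sum>i=1..l. \<mu> i *\<^sub>R grad (g i) x)"
    and "\<And>i. i \<in> E2 \<Longrightarrow> \<mu> i \<ge> 0"
    and "\<And>i. i \<in> E2 \<Longrightarrow> \<mu> i * peval (g i) (($) x) = 0"
proof -
  have E2: "E2 \<subseteq> {1..l}" using E by auto
  have X: "constraint_set g E1 E2 = {u. (\<forall>i\<in>{1..l} - E2. peval (g i) (($) u) = 0) \<and>
      (\<forall>i\<in>E2. peval (g i) (($) u) \<ge> 0)}"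
  proof -
    have "E1 = {1..l} - E2" using E by auto
    then show ?thesis by (simp add: constraint_set_def)
  qed
  have c: "continuous_on UNIV (\<lambda>u::real^'n. (\<chi> p. peval (L i (Inl p)) (($) u)) :: real^'n)"
    "continuous_on UNIV (\<lambda>u::real^'n. peval (L i (Inr j)) (($) u) :: real)" for i j
    by (intro continuous_intros continuous_on_peval)+
  have \<mu>: "(\<chi> p. peval (L i (Inl p)) (($) x)) \<bullet> \<phi>' x = \<mu> i" for i
    by (simp add: \<mu>_def inner_vec_def)
  note KKT = lagrange_multipliers_of_minimizer[OF finite_atLeastAtMost E2 d\<phi> has_derivative_peval_grad
      c\<phi> continuous_on_grad c left_inverse_mat_eval[OF L] X, of x, unfolded \<mu>]
  show "\<phi>' x = (\<Sum>i=1..l. \<mu> i *\<^sub>R grad (g i) x)"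
    by (rule KKT(1)) (use x in \<open>auto simp: in_minimizers_iff\<close>)
  show "\<mu> i \<ge> 0" if "i \<in> E2" for i
    by (rule KKT(2)) (use x that in \<open>auto simp: in_minimizers_iff\<close>)
  show "\<mu> i * peval (g i) (($) x) = 0" if "i \<in> E2" for i
    by (rule KKT(3)) (use x that in \<open>auto simp: in_minimizers_iff\<close>)
qed

lemma minimizers_subset_kkt_x:
  assumes "E1 \<union> E2 = {1..l}" "E1 \<inter> E2 = {}" "left_inverse_mat l G1 g"
  shows "minimizers (\<lambda>u. eval_xy F u y) (constraint_set g E1 E2) \<subseteq> kkt_x F l g E1 E2 G1 y"
proof
  fix x assume x: "x \<in> minimizers (\<lambda>u. eval_xy F u y) (constraint_set g E1 E2)"
  note KKT = constraint_set_minimizer_KKT[OF assms has_derivative_eval_xy_left continuous_on_grad_x x,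
      folded lagrange_x_def]
  from x have "x \<in> constraint_set g E1 E2"
    by (simp add: in_minimizers_iff)
  with KKT show "x \<in> kkt_x F l g E1 E2 G1 y"
    by (simp add: kkt_x_def constraint_set_def)
qed

text \<open>Maximizing is minimizing the negated objective. This negates the gradient and hence the
  multipliers, which is why their sign condition is reversed.\<close>

lemma maximizers_subset_kkt_y:
  assumes "E1 \<union> E2 = {1..l}" "E1 \<inter> E2 = {}" "left_inverse_mat l H1 h"
  shows "maximizers (\<lambda>v. eval_xy F x v) (constraint_set h E1 E2) \<subseteq> kkt_y F l h E1 E2 H1 x"
proof
  fix y assume y: "y \<in> maximizers (\<lambda>v. eval_xy F x v) (constraint_set h E1 E2)"
  then have y': "y \<in> minimizers (\<lambda>v. - eval_xy F x v) (constraint_set h E1 E2)"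
    by (simp add: in_minimizers_iff in_maximizers_iff)
  have "((\<lambda>v. - eval_xy F x v) has_derivative (\<lambda>d. - grad_y F x u \<bullet> d)) (at u)" for u
    using has_derivative_minus[OF has_derivative_eval_xy_right] by simp
  note KKT = constraint_set_minimizer_KKT[OF assms this continuous_on_minus[OF continuous_on_grad_y] y']
  have l: "(\<Sum>q\<in>UNIV. peval (H1 j (Inl q)) (($) y) * (- grad_y F x y) $ q) = - lagrange_y F H1 j x y" for j
    by (simp add: lagrange_y_def sum_negf)
  from y have "y \<in> constraint_set h E1 E2"
    by (simp add: in_maximizers_iff)
  with KKT show "y \<in> kkt_y F l h E1 E2 H1 x"
    unfolding l by (simp add: kkt_y_def constraint_set_def sum_negf)
qed

subsection \<open>The algorithm\<close>

lemma theta1_eq: "u \<in> minimizers (\<lambda>u. f u y) (C1 y) \<Longrightarrow> theta1 f C1 y = f u y"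
  unfolding theta1_def by (rule cInf_eq_minimum) (auto simp: in_minimizers_iff)

lemma theta2_eq: "v \<in> maximizers (\<lambda>v. f x v) (C2 x) \<Longrightarrow> theta2 f C2 x = f x v"
  unfolding theta2_def by (rule cSup_eq_maximum) (auto simp: in_maximizers_iff)

lemma in_saddle_points_iff:
  "(x, y) \<in> saddle_points f X Y \<longleftrightarrow>
     x \<in> minimizers (\<lambda>u. f u y) X \<and> y \<in> maximizers (\<lambda>v. f x v) Y"
  by (auto simp: saddle_points_def in_minimizers_iff in_maximizers_iff)

text \<open>The rest of the argument involves no polynomials: KKT points enter only through the fact
  that they lie between the global optimizers and the feasible set.\<close>

locale saddle_algorithm =
  fixes f :: "'a \<Rightarrow> 'b \<Rightarrow> real" and X :: "'a set" and Y :: "'b set"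
    and C1 :: "'b \<Rightarrow> 'a set" and C2 :: "'a \<Rightarrow> 'b set"
  assumes C1_subset: "C1 y \<subseteq> X"
    and C2_subset: "C2 x \<subseteq> Y"
    and minimizers_subset_C1: "minimizers (\<lambda>u. f u y) X \<subseteq> C1 y"
    and maximizers_subset_C2: "maximizers (\<lambda>v. f x v) Y \<subseteq> C2 x"
begin

definition "K0 = {(x, y). x \<in> C1 y \<and> y \<in> C2 x}"

definition "S = saddle_points f X Y"

text \<open>On termination only optimality among KKT points is recorded, since this is what the test
  decides. While running, \<open>K\<close> is nonempty so that every iteration has a candidate to
  cut off.\<close>

fun invariant :: "('a, 'b) config \<Rightarrow> bool" where
  "invariant (Running K1 K2 Sa K) \<longleftrightarrow>
     K1 \<subseteq> X \<and> K2 \<subseteq> Y \<and> Sa = {} \<and> K \<noteq> {} \<and> K \<subseteq> cut_set f K0 K1 K2"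
| "invariant (Stopped Sa) \<longleftrightarrow> (Sa = {} \<longrightarrow> S = {}) \<and>
     (\<forall>(x, y)\<in>Sa. x \<in> minimizers (\<lambda>u. f u y) (C1 y) \<and> y \<in> maximizers (\<lambda>v. f x v) (C2 x))"

text \<open>A global optimizer is itself a KKT point, hence optimal in the smaller set of KKT points
  as well.\<close>

lemma saddle_point_KKT_optimal:
  assumes "(x, y) \<in> S"
  shows "x \<in> minimizers (\<lambda>u. f u y) (C1 y)" "y \<in> maximizers (\<lambda>v. f x v) (C2 x)"
proof -
  from assms have x: "x \<in> minimizers (\<lambda>u. f u y) X" and y: "y \<in> maximizers (\<lambda>v. f x v) Y"
    by (simp_all add: S_def in_saddle_points_iff)
  show "x \<in> minimizers (\<lambda>u. f u y) (C1 y)"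
    using x subsetD[OF minimizers_subset_C1 x] C1_subset[of y] by (auto simp: in_minimizers_iff)
  show "y \<in> maximizers (\<lambda>v. f x v) (C2 x)"
    using y subsetD[OF maximizers_subset_C2 y] C2_subset[of x] by (auto simp: in_maximizers_iff)
qed

lemma S_subset_K0: "S \<subseteq> K0"
  using saddle_point_KKT_optimal by (auto simp: K0_def in_minimizers_iff in_maximizers_iff)

text \<open>At a saddle point each cut is an instance of a saddle point inequality.\<close>

lemma S_subset_cut_set: "K1 \<subseteq> X \<Longrightarrow> K2 \<subseteq> Y \<Longrightarrow> S \<subseteq> cut_set f K0 K1 K2"
  using S_subset_K0 by (auto simp: cut_set_def S_def saddle_points_def subset_iff)

text \<open>If the optimum over \<open>X\<close> is attained, it is attained at a KKT point, so the
  optimal value among KKT points is the global one; likewise over \<open>Y\<close>.\<close>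

lemma KKT_optimal_imp_saddle_point:
  assumes x: "x \<in> minimizers (\<lambda>u. f u y) (C1 y)" and y: "y \<in> maximizers (\<lambda>v. f x v) (C2 x)"
    and "minimizers (\<lambda>u. f u y) X \<noteq> {}" "maximizers (\<lambda>v. f x v) Y \<noteq> {}"
  shows "(x, y) \<in> S"
proof -
  from assms obtain u v where u: "u \<in> minimizers (\<lambda>u. f u y) X" and v: "v \<in> maximizers (\<lambda>v. f x v) Y"
    by blast
  have "f x y \<le> f u y" "f x v \<le> f x y"
    using subsetD[OF minimizers_subset_C1 u] subsetD[OF maximizers_subset_C2 v] x y
    by (auto simp: in_minimizers_iff in_maximizers_iff)
  moreover have "x \<in> X" "y \<in> Y"
    using x y C1_subset[of y] C2_subset[of x] by (auto simp: in_minimizers_iff in_maximizers_iff)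
  ultimately show ?thesis
    using u v unfolding S_def in_saddle_points_iff in_minimizers_iff in_maximizers_iff
    by (meson order_trans)
qed

section \<open>The test of the candidates and its effect on the cuts\<close>

lemma test_candidates_mono:
  assumes "test_candidates f C1 C2 K K1 K2 Sa K1' K2' Sa'"
  shows "K1 \<subseteq> K1'" "K2 \<subseteq> K2'" "K1 \<subseteq> X \<Longrightarrow> K1' \<subseteq> X" "K2 \<subseteq> Y \<Longrightarrow> K2' \<subseteq> Y"
proof -
  from assms obtain S1 S2 where
      S: "\<And>x y. (x, y) \<in> K \<Longrightarrow> S1 y \<subseteq> minimizers (\<lambda>u. f u y) (C1 y)"
        "\<And>x y. (x, y) \<in> K \<Longrightarrow> S2 x \<subseteq> maximizers (\<lambda>v. f x v) (C2 x)"
    and K1': "K1' = K1 \<union> \<Union>{S1 y | x y. (x, y) \<in> K \<and> f x y > theta1 f C1 y}"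
    and K2': "K2' = K2 \<union> \<Union>{S2 x | x y. (x, y) \<in> K \<and> f x y < theta2 f C2 x}"
    unfolding test_candidates_def by blast
  have "minimizers (\<lambda>u. f u y) (C1 y) \<subseteq> X" "maximizers (\<lambda>v. f x v) (C2 x) \<subseteq> Y" for x y
    using C1_subset[of y] C2_subset[of x] by (auto simp: in_minimizers_iff in_maximizers_iff)
  with S have "S1 y \<subseteq> X" "S2 x \<subseteq> Y" if "(x, y) \<in> K" for x y
    using that by (meson order_trans)+
  then show "K1 \<subseteq> K1'" "K2 \<subseteq> K2'" "K1 \<subseteq> X \<Longrightarrow> K1' \<subseteq> X" "K2 \<subseteq> Y \<Longrightarrow> K2' \<subseteq> Y"
    unfolding K1' K2' by blast+
qed

text \<open>A candidate from \<open>K0\<close> is feasible for both KKT problems, so attaining an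
  optimal value is the same as being an optimizer.\<close>

lemma passed_iff:
  assumes "test_candidates f C1 C2 K K1 K2 {} K1' K2' Sa'" "K \<subseteq> K0"
  shows "(x, y) \<in> Sa' \<longleftrightarrow> (x, y) \<in> K \<and>
    x \<in> minimizers (\<lambda>u. f u y) (C1 y) \<and> y \<in> maximizers (\<lambda>v. f x v) (C2 x)"
proof (cases "(x, y) \<in> K")
  case True
  with assms obtain u v where u: "u \<in> minimizers (\<lambda>u. f u y) (C1 y)"
      and v: "v \<in> maximizers (\<lambda>v. f x v) (C2 x)"
    unfolding test_candidates_def by fast
  have "(x, y) \<in> Sa' \<longleftrightarrow> f u y = f x y \<and> f x y = f x v"
    using assms True unfolding test_candidates_def theta1_eq[of _ f _ C1, OF u, symmetric] theta2_eq[of _ f _ C2, OF v, symmetric]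
    by auto
  also have "\<dots> \<longleftrightarrow> x \<in> minimizers (\<lambda>u. f u y) (C1 y) \<and> y \<in> maximizers (\<lambda>v. f x v) (C2 x)"
    using u v True assms(2) by (force simp: in_minimizers_iff in_maximizers_iff K0_def)
  finally show ?thesis using True by simp
next
  case False
  with assms show ?thesis by (auto simp: test_candidates_def)
qed

text \<open>Feasibility of the candidate gives \<open>f u y <= f x y <= f x v\<close> for the
  computed optimizers \<open>u\<close> and \<open>v\<close>. Failing the test makes one inequality
  strict, so that optimizer is collected and its cut is violated at \<open>(x, y)\<close>.\<close>

lemma failed_candidate_cut_off:
  assumes test: "test_candidates f C1 C2 K K1 K2 Sa K1' K2' Sa'" and K: "K \<subseteq> K0"
    and xy: "(x, y) \<in> K" "(x, y) \<notin> Sa'"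
  shows "(x, y) \<notin> cut_set f K0 K1' K2'"
proof -
  from test obtain S1 S2 where
      S: "\<forall>(x, y)\<in>K. S1 y \<noteq> {} \<and> S1 y \<subseteq> minimizers (\<lambda>u. f u y) (C1 y) \<and>
        S2 x \<noteq> {} \<and> S2 x \<subseteq> maximizers (\<lambda>v. f x v) (C2 x)"
    and K1': "K1' = K1 \<union> \<Union>{S1 y | x y. (x, y) \<in> K \<and> f x y > theta1 f C1 y}"
    and K2': "K2' = K2 \<union> \<Union>{S2 x | x y. (x, y) \<in> K \<and> f x y < theta2 f C2 x}"
    and Sa': "Sa' = Sa \<union> {(x, y) \<in> K. theta1 f C1 y = f x y \<and> f x y = theta2 f C2 x}"
    unfolding test_candidates_def by blast
  from S xy obtain u v where uv: "u \<in> S1 y" "v \<in> S2 x"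
    and u: "u \<in> minimizers (\<lambda>u. f u y) (C1 y)" and v: "v \<in> maximizers (\<lambda>v. f x v) (C2 x)"
    by fast
  note \<theta> = theta1_eq[of _ f _ C1, OF u] theta2_eq[of _ f _ C2, OF v]
  have "f u y \<le> f x y" "f x y \<le> f x v"
    using u v xy K by (auto simp: in_minimizers_iff in_maximizers_iff K0_def)
  moreover have "\<not> (f u y = f x y \<and> f x y = f x v)"
    using xy unfolding Sa' \<theta>[symmetric] by auto
  ultimately consider "f u y < f x y" | "f x y < f x v" by linarith
  then show ?thesis
  proof cases
    case 1
    then have "u \<in> K1'" using uv xy unfolding K1' \<theta>(1)[symmetric] by auto
    with 1 show ?thesis by (force simp: cut_set_def)
  next
    case 2
    then have "v \<in> K2'" using uv xy unfolding K2' \<theta>(2)[symmetric] by auto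
    with 2 show ?thesis by (force simp: cut_set_def)
  qed
qed

lemma cut_set_subset_K0: "cut_set f K0 K1 K2 \<subseteq> K0"
  by (auto simp: cut_set_def)

text \<open>If \<open>K0\<close> is empty, then so is its subset \<open>S\<close>; and before the
  first cut, \<open>cut_set\<close> is all of \<open>K0\<close>.\<close>

lemma invariant_init: "alg_init f K0 c \<Longrightarrow> invariant c"
  by (induction rule: alg_init.induct)
    (use S_subset_K0 in \<open>auto simp: cut_set_def in_minimizers_iff\<close>)

lemma invariant_step:
  assumes "alg_step f K0 C1 C2 c c'" "invariant c"
  shows "invariant c'"
  using assms
proof cases
  case (report_output K K1 K2 Sa K1' K2' Sa')
  with assms(2) have "test_candidates f C1 C2 K K1 K2 {} K1' K2' Sa'" "K \<subseteq> cut_set f K0 K1 K2"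
    by simp_all
  note passed_iff[OF this(1) order_trans[OF this(2) cut_set_subset_K0]]
  with report_output show ?thesis by auto
next
  case (report_infeasible K K1 K2 Sa K1' K2' Sa')
  then show ?thesis
    using assms(2) test_candidates_mono[of K K1 K2 Sa K1' K2' Sa'] S_subset_cut_set[of K1' K2'] by auto
next
  case (next_candidates K K1 K2 Sa K1' K2' Sa' K')
  moreover have "K' \<subseteq> cut_set f K0 K1' K2'"
    using next_candidates by (auto simp: in_minimizers_iff)
  ultimately show ?thesis
    using assms(2) test_candidates_mono[of K K1 K2 Sa K1' K2' Sa'] by auto
next
  case remain_stopped
  with assms(2) show ?thesis by simp
qed

lemma invariant_execution:
  assumes "alg_execution f K0 C1 C2 c"
  shows "invariant (c k)"
  using assms by (induction k) (auto simp: alg_execution_def intro: invariant_init invariant_step)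

section \<open>Termination\<close>

fun potential :: "('a, 'b) config \<Rightarrow> nat" where
  "potential (Running K1 K2 Sa K) = card (cut_set f K0 K1 K2 - S)"
| "potential (Stopped Sa) = 0"

lemma potential_decreases:
  assumes "alg_step f K0 C1 C2 c c'" "invariant c" "finite (K0 - S)" "\<nexists>Sa. c' = Stopped Sa"
  shows "potential c' < potential c"
  using assms(1)
proof cases
  case (next_candidates K K1 K2 Sa K1' K2' Sa' K')
  with assms(2) have Sa: "Sa = {}" and K: "K \<noteq> {}" "K \<subseteq> cut_set f K0 K1 K2" by auto
  then have K_K0: "K \<subseteq> K0" using cut_set_subset_K0 by auto
  note test = next_candidates(3)
  from K(1) obtain x y where xy: "(x, y) \<in> K" by auto
  \<comment> \<open>A saddle point among the candidates would have passed, but \<open>Sa'\<close> is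
    empty.\<close>
  have "(x, y) \<notin> S"
    using saddle_point_KKT_optimal[of x y] passed_iff[OF test[unfolded Sa] K_K0, of x y] xy
      next_candidates(4) by auto
  moreover have "(x, y) \<notin> cut_set f K0 K1' K2'"
    using failed_candidate_cut_off[OF test K_K0 xy] next_candidates(4) by auto
  moreover have "cut_set f K0 K1' K2' \<subseteq> cut_set f K0 K1 K2"
    using test_candidates_mono(1,2)[OF test] by (auto simp: cut_set_def)
  ultimately have "cut_set f K0 K1' K2' - S \<subset> cut_set f K0 K1 K2 - S"
    using xy K(2) by blast
  moreover have "finite (cut_set f K0 K1 K2 - S)"
    using assms(3) by (rule finite_subset[rotated]) (use cut_set_subset_K0 in blast)
  ultimately show ?thesis
    using next_candidates by (simp add: psubset_card_mono)
qed (use assms(4) in auto)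

lemma terminates:
  assumes c: "alg_execution f K0 C1 C2 c" and fin: "finite (K0 - S)"
  shows "\<exists>N Sa. c N = Stopped Sa"
proof (rule ccontr)
  assume "\<nexists>N Sa. c N = Stopped Sa"
  then have less: "potential (c (Suc k)) < potential (c k)" for k
    using c invariant_execution[OF c] fin
    by (intro potential_decreases) (auto simp: alg_execution_def)
  \<comment> \<open>A strictly decreasing sequence of naturals cannot last longer than its initial
    value.\<close>
  have "potential (c k) + k \<le> potential (c 0)" for k
  proof (induction k)
    case (Suc k)
    with less[of k] show ?case by linarith
  qed simp
  from this[of "Suc (potential (c 0))"] show False by simp
qed

end

text \<open>The test compares values at KKT points only, so the saddle point claim for
  \<open>Sa\<close> is made where the optima over \<open>X\<close> and \<open>Y\<close> are
  attained. For \<open>F = x^3 - y^2\<close> without constraints, the only KKT point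
  \<open>(0, 0)\<close> passes the test, yet \<open>F(., 0)\<close> is unbounded below.\<close>

theorem theorem3p2:
  fixes F :: "('n::finite + 'm::finite) rpoly"
    and g :: "nat \<Rightarrow> 'n rpoly" and h :: "nat \<Rightarrow> 'm rpoly"
    and l1 l2 :: nat
    and E1X E2X E1Y E2Y :: "nat set"
    and G1 :: "nat \<Rightarrow> 'n + nat \<Rightarrow> 'n rpoly"
    and H1 :: "nat \<Rightarrow> 'm + nat \<Rightarrow> 'm rpoly"
    and X :: "(real^'n) set" and Y :: "(real^'m) set"
    and f :: "real^'n \<Rightarrow> real^'m \<Rightarrow> real"
    and C1 :: "real^'m \<Rightarrow> (real^'n) set" and C2 :: "real^'n \<Rightarrow> (real^'m) set"
    and K0 S :: "((real^'n) \<times> (real^'m)) set"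
  assumes "E1X \<union> E2X = {1..l1}" and "E1X \<inter> E2X = {}"
    and "E1Y \<union> E2Y = {1..l2}" and "E1Y \<inter> E2Y = {}"
    and X_def: "X = constraint_set g E1X E2X"
    and Y_def: "Y = constraint_set h E1Y E2Y"
    and "nonsingular l1 g" and "nonsingular l2 h"
    and "left_inverse_mat l1 G1 g" and "left_inverse_mat l2 H1 h"
    and f_def: "f = eval_xy F"
    and C1_def: "C1 = kkt_x F l1 g E1X E2X G1"
    and C2_def: "C2 = kkt_y F l2 h E1Y E2Y H1"
    and K0_def: "K0 = {(x, y). x \<in> C1 y \<and> y \<in> C2 x}"
    and S_def: "S = saddle_points f X Y"
  shows "\<forall>c. alg_execution f K0 C1 C2 c \<longrightarrow>
    (finite (K0 - S) \<longrightarrow> (\<exists>N Sa. c N = Stopped Sa)) \<and>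
    (\<forall>N Sa. c N = Stopped Sa \<longrightarrow>
      (Sa \<noteq> {} \<longrightarrow> (\<forall>(x, y)\<in>Sa.
         minimizers (\<lambda>u. f u y) X \<noteq> {} \<and> maximizers (\<lambda>v. f x v) Y \<noteq> {} \<longrightarrow> (x, y) \<in> S)) \<and>
      (Sa = {} \<longrightarrow> S = {}))"
proof -
  interpret alg: saddle_algorithm f X Y C1 C2
  proof
    show "C1 y \<subseteq> X" for y
      by (auto simp: C1_def X_def kkt_x_def)
    show "C2 x \<subseteq> Y" for x
      by (auto simp: C2_def Y_def kkt_y_def)
    show "minimizers (\<lambda>u. f u y) X \<subseteq> C1 y" for y
      unfolding f_def X_def C1_def by (rule minimizers_subset_kkt_x) fact+
    show "maximizers (\<lambda>v. f x v) Y \<subseteq> C2 x" for x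
      unfolding f_def Y_def C2_def by (rule maximizers_subset_kkt_y) fact+
  qed
  have K0: "K0 = alg.K0" and S: "S = alg.S"
    by (simp_all add: K0_def S_def alg.K0_def alg.S_def)
  show ?thesis
    unfolding K0 S
  proof (intro allI impI conjI)
    fix c assume c: "alg_execution f alg.K0 C1 C2 c"
    show "\<exists>N Sa. c N = Stopped Sa" if "finite (alg.K0 - alg.S)"
      using alg.terminates[OF c that] .
    fix N Sa assume "c N = Stopped Sa"
    with alg.invariant_execution[OF c, of N] have inv: "alg.invariant (Stopped Sa)" by simp
    have "(x, y) \<in> alg.S" if "(x, y) \<in> Sa"
      "minimizers (\<lambda>u. f u y) X \<noteq> {}" "maximizers (\<lambda>v. f x v) Y \<noteq> {}" for x y
      using inv that by (intro alg.KKT_optimal_imp_saddle_point) auto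
    then show "\<forall>(x, y)\<in>Sa. minimizers (\<lambda>u. f u y) X \<noteq> {} \<and> maximizers (\<lambda>v. f x v) Y \<noteq> {} \<longrightarrow>
        (x, y) \<in> alg.S"
      by blast
    show "alg.S = {}" if "Sa = {}"
      using inv that by simp
  qed
qed

end
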